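(* Let $H$ be a separable Hilbert space and let $\{x_n\}$ be a sequence of nonzero elements of $H$ that admits an orthogonal decomposition $\{x_n\}=\{x_n^1\}\cup\{x_n^2\}\cup\cdots$, and assume that $$\sup_i \dim\bigl(\overline{\mathrm{span}}\{x_n^i\}_n\bigr)<\infty .$$ Then $\{x_n\}$ is Bessel-normalizable if and only if $\sup_i|\{x_n^i\}_n|<\infty$, where $|\{x_n^i\}_n|$ denotes the cardinality of $\{x_n^i\}_n$.
   Context: A sequence $\{z_n\}$ in $H$ is a Bessel sequence if there is a constant $B$ with $\sum_n|\langle x,z_n\rangle|^2\le B\|x\|^2$ for all $x\in H$. A sequence $\{x_n\}$ of nonzero elements is Bessel-normalizable if $\{x_n/\|x_n\|\}$ is a Bessel sequence. A sequence $\{x_n\}$ admits an orthogonal decomposition if it is partitioned (as an indexed family) into finitely or countably many (finite or infinite) subsequences $\{x_n^1\}_n,\{x_n^2\}_n,\dots$ such that $\overline{\mathrm{span}}\{x_n^i\}_n\perp\overline{\mathrm{span}}\{x_n^j\}_n$ for $i\ne j$. The cardinality of a subsequence is its number of terms, repetitions counted. *)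

theory Defs
  imports "HOL-Analysis.Analysis"
begin

text \<open>
  The scalar field of a Hilbert space: the reals or the complex numbers. The axioms force
  this: every \<open>x + conj x\<close> and every \<open>conj x * x\<close> is real, so each scalar satisfies
  a quadratic equation over the reals, and a field with that property is isomorphic to
  the reals or to the complex numbers.
\<close>

class hilbert_scalar = real_normed_field +
  fixes conj :: "'a \<Rightarrow> 'a"
  assumes conj_add: "conj (x + y) = conj x + conj y"
    and conj_mult: "conj (x * y) = conj x * conj y"
    and conj_conj: "conj (conj x) = x"
    and conj_mult_self: "conj x * x = (norm x)\<^sup>2 *\<^sub>R 1"

instantiation real :: hilbert_scalar
begin
definition conj_real :: "real \<Rightarrow> real" where "conj_real x = x"
instance by standard (simp_all add: conj_real_def power2_eq_square)
end

instantiation complex :: hilbert_scalar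
begin
definition conj_complex :: "complex \<Rightarrow> complex" where "conj_complex = cnj"
instance
  by standard
    (simp_all add: conj_complex_def complex_norm_square mult.commute scaleR_conv_of_real del: of_real_power)
end

text \<open>
  A Hilbert space over \<^typ>\<open>'k\<close> on the whole type \<^typ>\<open>'a\<close>. The norm, the topology and
  completeness come from the type class; the last two axioms tie them to the scalar
  multiplication \<open>smul\<close> and the inner product \<open>ip\<close> (linear in the first argument).
  Definiteness of \<open>ip\<close> follows from \<open>ip_self\<close>.
\<close>

locale hilbert_space = vector_space smul
  for smul :: "'k::hilbert_scalar \<Rightarrow> 'a::{real_normed_vector, complete_space} \<Rightarrow> 'a" +
  fixes ip :: "'a \<Rightarrow> 'a \<Rightarrow> 'k"
  assumes ip_add_left: "ip (x + y) z = ip x z + ip y z"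
    and ip_scale_left: "ip (smul c x) y = c * ip x y"
    and ip_conj: "ip y x = conj (ip x y)"
    and ip_self: "ip x x = of_real ((norm x)\<^sup>2)"
    and scale_of_real: "smul (of_real r) x = r *\<^sub>R x"

lemma hilbert_space_real:
  "hilbert_space (scaleR :: real \<Rightarrow> 'a::{real_inner, complete_space} \<Rightarrow> 'a) inner"
  by unfold_locales
    (simp_all add: algebra_simps inner_add_left inner_commute conj_real_def power2_norm_eq_inner)

lemma hilbert_space_complex:
  "hilbert_space ((*) :: complex \<Rightarrow> complex \<Rightarrow> complex) (\<lambda>x y. x * cnj y)"
  by unfold_locales
    (simp_all add: algebra_simps conj_complex_def complex_norm_square scaleR_conv_of_real
      del: of_real_power)

definition bessel_sequence ::
    "('a::real_normed_vector \<Rightarrow> 'a \<Rightarrow> 'k::hilbert_scalar) \<Rightarrow> (nat \<Rightarrow> 'a) \<Rightarrow> bool" where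
  "bessel_sequence ip z \<longleftrightarrow>
    (\<exists>B::real. \<forall>x. summable (\<lambda>n. (norm (ip x (z n)))\<^sup>2) \<and>
      (\<Sum>n. (norm (ip x (z n)))\<^sup>2) \<le> B * (norm x)\<^sup>2)"

definition bessel_normalizable ::
    "('a::real_normed_vector \<Rightarrow> 'a \<Rightarrow> 'k::hilbert_scalar) \<Rightarrow> (nat \<Rightarrow> 'a) \<Rightarrow> bool" where
  "bessel_normalizable ip x \<longleftrightarrow>
    (\<forall>n. x n \<noteq> 0) \<and> bessel_sequence ip (\<lambda>n. (1 / norm (x n)) *\<^sub>R x n)"

definition closed_span ::
    "('k::hilbert_scalar \<Rightarrow> 'a::real_normed_vector \<Rightarrow> 'a) \<Rightarrow> 'a set \<Rightarrow> 'a set" where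
  "closed_span smul S = closure (module.span smul S)"

text \<open>
  The \<open>i\<close>-th subsequence is the restriction of \<open>x\<close> to the index set \<open>N i\<close>, for \<open>i\<close> in
  a finite or infinite set \<open>J\<close> of labels. Partitioning the indices rather than the range of
  \<open>x\<close> keeps track of repetitions.
\<close>

definition orthogonal_decomposition ::
    "('k::hilbert_scalar \<Rightarrow> 'a::real_normed_vector \<Rightarrow> 'a) \<Rightarrow> ('a \<Rightarrow> 'a \<Rightarrow> 'k) \<Rightarrow>
      (nat \<Rightarrow> 'a) \<Rightarrow> nat set \<Rightarrow> (nat \<Rightarrow> nat set) \<Rightarrow> bool" where
  "orthogonal_decomposition smul ip x J N \<longleftrightarrow>
    (\<forall>i\<in>J. N i \<noteq> {}) \<and> disjoint_family_on N J \<and> (\<Union>i\<in>J. N i) = UNIV \<and>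
    (\<forall>i\<in>J. \<forall>j\<in>J. i \<noteq> j \<longrightarrow>
      (\<forall>u\<in>closed_span smul (x ` N i). \<forall>v\<in>closed_span smul (x ` N j). ip u v = 0))"

text \<open>
  Dimension and cardinality with value \<open>\<infinity>\<close> in the infinite case, where the library's
  \<open>dim\<close> and \<open>card\<close> do not tell infinite from finite.
\<close>

definition edim ::
    "('k::field \<Rightarrow> 'a::ab_group_add \<Rightarrow> 'a) \<Rightarrow> 'a set \<Rightarrow> enat" where
  "edim smul V =
    (if \<exists>B. finite B \<and> V \<subseteq> module.span smul B then enat (vector_space.dim smul V) else \<infinity>)"

definition ecard :: "'b set \<Rightarrow> enat" where
  "ecard A = (if finite A then enat (card A) else \<infinity>)"

end

theory Submission
  imports Defs
begin

text \<open>
  If the blocks have at most \<open>M\<close> members, then by Pythagoras across the blocks and the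
  Cauchy--Schwarz inequality inside each block the synthesis operator
  \<open>c \<mapsto> \<Sum>n. c n z\<^sub>n\<close> of the normalized sequence \<open>z\<close> has squared norm at
  most \<open>M\<close>, and by duality so has the analysis operator, i.e. \<open>M\<close> is a Bessel bound.
  Conversely, if \<open>z\<close> has Bessel bound \<open>B\<close> and a block spans a space with orthonormal basis \<open>E\<close>, then
  summing the Parseval identities \<open>1 = \<Sum>e\<in>E. |\<langle>z\<^sub>n, e\<rangle>|\<^sup>2\<close> over the block
  and exchanging the sums shows that the block has at most \<open>B * card E\<close> members.
\<close>

section \<open>Conjugation and norm on the scalar field\<close>

lemma conj_zero [simp]: "conj (0::'k::hilbert_scalar) = 0"
  using conj_add[of "0::'k" 0] by simp

text \<open>As \<open>conj\<close> is an involution, \<open>conj_mult_self\<close> at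
  \<open>c\<close> and at \<open>conj c\<close> describes the same product, so the two squared norms
  agree.\<close>

lemma norm_conj [simp]: "norm (conj c) = norm (c::'k::hilbert_scalar)"
proof -
  have "of_real ((norm (conj c))\<^sup>2) = (of_real ((norm c)\<^sup>2) :: 'k)"
    using conj_mult_self[of c] conj_mult_self[of "conj c"]
    by (simp add: conj_conj mult.commute scaleR_conv_of_real)
  then have "(norm (conj c))\<^sup>2 = (norm c)\<^sup>2"
    using of_real_eq_iff by blast
  then show ?thesis by simp
qed

lemma mult_conj: "c * conj c = of_real ((norm (c::'k::hilbert_scalar))\<^sup>2)"
  using conj_mult_self[of c] by (simp add: mult.commute scaleR_conv_of_real)

section \<open>Inner product calculus, Pythagoras and Cauchy--Schwarz\<close>

context hilbert_space
begin

lemma ip_zero_left [simp]: "ip 0 y = 0"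
  using ip_add_left[of 0 0 y] by simp

lemma ip_zero_right [simp]: "ip x 0 = 0"
  using ip_conj[of x 0] by simp

lemma ip_add_right: "ip x (y + z) = ip x y + ip x z"
  by (metis ip_conj ip_add_left conj_add)

lemma ip_scale_right: "ip x (smul c y) = conj c * ip x y"
  by (metis ip_conj ip_scale_left conj_mult)

lemma ip_diff_left: "ip (x - y) z = ip x z - ip y z"
  using ip_add_left[of "x - y" y z] by simp

lemma ip_sum_left: "ip (sum f A) y = (\<Sum>i\<in>A. ip (f i) y)"
  by (induction A rule: infinite_finite_induct) (simp_all add: ip_add_left)

lemma ip_sum_right: "ip x (sum f A) = (\<Sum>i\<in>A. ip x (f i))"
  by (induction A rule: infinite_finite_induct) (simp_all add: ip_add_right)

lemma ip_eq_zero_sym: "ip x y = 0 \<Longrightarrow> ip y x = 0"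
  by (metis ip_conj conj_zero)

lemma norm_ip_commute: "norm (ip x y) = norm (ip y x)"
  by (metis ip_conj norm_conj)

lemma norm_smul: "norm (smul c x) = norm c * norm x"
proof -
  have "ip (smul c x) (smul c x) = (c * conj c) * ip x x"
    by (simp add: ip_scale_left ip_scale_right mult.assoc)
  then have "of_real ((norm (smul c x))\<^sup>2) = (of_real ((norm c * norm x)\<^sup>2) :: 'k)"
    unfolding ip_self mult_conj power_mult_distrib by simp
  then have "(norm (smul c x))\<^sup>2 = (norm c * norm x)\<^sup>2"
    using of_real_eq_iff by blast
  then show ?thesis by simp
qed

lemma pythagoras:
  assumes "ip x y = 0"
  shows "(norm (x + y))\<^sup>2 = (norm x)\<^sup>2 + (norm y)\<^sup>2"
proof -
  have "of_real ((norm (x + y))\<^sup>2) = (of_real ((norm x)\<^sup>2 + (norm y)\<^sup>2) :: 'k)"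
    unfolding of_real_add ip_self[symmetric]
    using assms ip_eq_zero_sym[OF assms] by (simp add: ip_add_left ip_add_right)
  then show ?thesis
    using of_real_eq_iff by blast
qed

lemma pythagoras_sum:
  assumes "finite A"
    and "\<And>i j. i \<in> A \<Longrightarrow> j \<in> A \<Longrightarrow> i \<noteq> j \<Longrightarrow> ip (f i) (f j) = 0"
  shows "(norm (\<Sum>i\<in>A. f i))\<^sup>2 = (\<Sum>i\<in>A. (norm (f i))\<^sup>2)"
  using assms
proof (induction A)
  case empty
  then show ?case by simp
next
  case (insert a A)
  have "ip (f a) (\<Sum>i\<in>A. f i) = 0"
    unfolding ip_sum_right by (rule sum.neutral) (use insert in auto)
  then show ?case
    using insert.hyps insert.IH insert.prems pythagoras[of "f a" "\<Sum>i\<in>A. f i"] by simp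
qed

text \<open>Removing from \<open>x\<close> its projection \<open>smul c y\<close> leaves a vector
  orthogonal to \<open>y\<close>, so by Pythagoras the projection is no longer than
  \<open>x\<close>.\<close>

lemma cauchy_schwarz: "norm (ip x y) \<le> norm x * norm y"
proof (cases "y = 0")
  case True
  then show ?thesis by simp
next
  case False
  define c where "c = ip x y / of_real ((norm y)\<^sup>2)"
  have "ip (x - smul c y) y = 0"
    using False by (simp add: ip_diff_left ip_scale_left ip_self c_def)
  then have "ip (x - smul c y) (smul c y) = 0"
    by (simp add: ip_scale_right)
  from pythagoras[OF this] have "(norm c * norm y)\<^sup>2 \<le> (norm x)\<^sup>2"
    by (simp add: norm_smul)
  then have "norm c * norm y \<le> norm x"
    by (rule power2_le_imp_le) simp
  then have "norm c * norm y * norm y \<le> norm x * norm y"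
    by (rule mult_right_mono) simp
  moreover have "ip x y = c * of_real ((norm y)\<^sup>2)"
    using False by (simp add: c_def)
  then have "norm (ip x y) = norm c * (norm y)\<^sup>2"
    by (simp only: norm_mult norm_of_real abs_power2)
  ultimately show ?thesis
    by (simp add: power2_eq_square mult.assoc)
qed

section \<open>Bounds for finite synthesis and analysis sums\<close>

text \<open>Duality: with the coefficients \<open>ip y (z n)\<close>, the sum \<open>S\<close> to be
  bounded equals \<open>ip w y\<close> for the synthesized vector \<open>w\<close>. Cauchy--Schwarz
  and the synthesis bound for \<open>w\<close> then bound \<open>S\<^sup>2\<close> by a multiple of
  \<open>S\<close>.\<close>

lemma analysis_bound:
  assumes "finite F" and "0 \<le> K"
    and synth: "\<And>c. (norm (\<Sum>n\<in>F. smul (c n) (z n)))\<^sup>2 \<le> K * (\<Sum>n\<in>F. (norm (c n))\<^sup>2)"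
  shows "(\<Sum>n\<in>F. (norm (ip y (z n)))\<^sup>2) \<le> K * (norm y)\<^sup>2"
proof -
  define S where "S = (\<Sum>n\<in>F. (norm (ip y (z n)))\<^sup>2)"
  define w where "w = (\<Sum>n\<in>F. smul (ip y (z n)) (z n))"
  have S0: "0 \<le> S"
    unfolding S_def by (simp add: sum_nonneg)
  have "ip w y = (\<Sum>n\<in>F. ip y (z n) * conj (ip y (z n)))"
    unfolding w_def ip_sum_left ip_scale_left by (rule sum.cong) (metis ip_conj)+
  also have "\<dots> = of_real S"
    unfolding S_def mult_conj by simp
  finally have "S = norm (ip w y)"
    using S0 by simp
  also have "\<dots> \<le> norm w * norm y"
    by (rule cauchy_schwarz)
  finally have "S\<^sup>2 \<le> (norm w)\<^sup>2 * (norm y)\<^sup>2"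
    using S0 power_mono[of S "norm w * norm y" 2] by (simp add: power_mult_distrib)
  also have "\<dots> \<le> K * S * (norm y)\<^sup>2"
    using synth[of "\<lambda>n. ip y (z n)"] unfolding w_def S_def by (rule mult_right_mono) simp
  finally have "S * S \<le> S * (K * (norm y)\<^sup>2)"
    by (simp add: power2_eq_square mult_ac)
  \<comment> \<open>A positive \<open>S\<close> cancels; for \<open>S = 0\<close> the claim rests on
    \<open>0 \<le> K\<close>.\<close>
  then have "S \<le> K * (norm y)\<^sup>2"
    using S0 \<open>0 \<le> K\<close> by (cases "S = 0") (auto simp: mult_le_cancel_left)
  then show ?thesis
    unfolding S_def .
qed

text \<open>The function \<open>g\<close> labels the block of each index. Block sums are mutually
  orthogonal, so only the passage from a block sum to its coefficients costs a factor, namely the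
  size of the block.\<close>

lemma synthesis_bound:
  assumes "finite F" and unit: "\<And>n. n \<in> F \<Longrightarrow> norm (z n) = 1"
    and orth: "\<And>m n. m \<in> F \<Longrightarrow> n \<in> F \<Longrightarrow> g m \<noteq> g n \<Longrightarrow> ip (z m) (z n) = 0"
    and card: "\<And>i. card {n \<in> F. g n = i} \<le> M"
  shows "(norm (\<Sum>n\<in>F. smul (c n) (z n)))\<^sup>2 \<le> real M * (\<Sum>n\<in>F. (norm (c n))\<^sup>2)"
proof -
  define v where "v i = (\<Sum>n | n \<in> F \<and> g n = i. smul (c n) (z n))" for i
  have "(norm (\<Sum>n\<in>F. smul (c n) (z n)))\<^sup>2 = (norm (\<Sum>i\<in>g ` F. v i))\<^sup>2"
    unfolding v_def by (subst sum.image_gen[OF \<open>finite F\<close>, of _ g]) simp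
  also have "\<dots> = (\<Sum>i\<in>g ` F. (norm (v i))\<^sup>2)"
  proof (rule pythagoras_sum)
    show "ip (v i) (v j) = 0" if "i \<noteq> j" for i j
      unfolding v_def ip_sum_left ip_sum_right ip_scale_left ip_scale_right
      by (intro sum.neutral ballI) (use that orth in auto)
  qed (use \<open>finite F\<close> in simp)
  also have "\<dots> \<le> (\<Sum>i\<in>g ` F. real M * (\<Sum>n | n \<in> F \<and> g n = i. (norm (c n))\<^sup>2))"
  proof (rule sum_mono)
    fix i
    let ?G = "{n \<in> F. g n = i}"
    have "norm (v i) \<le> (\<Sum>n\<in>?G. norm (c n))"
      unfolding v_def by (rule sum_norm_le) (simp add: norm_smul unit)
    then have "(norm (v i))\<^sup>2 \<le> (\<Sum>n\<in>?G. norm (c n))\<^sup>2"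
      by (simp add: power_mono)
    \<comment> \<open>Cauchy--Schwarz against the constant sequence 1.\<close>
    also have "\<dots> \<le> (\<Sum>n\<in>?G. (norm (c n))\<^sup>2) * real (card ?G)"
      by (rule sum_squared_le_sum_of_squares)
    also have "\<dots> \<le> real M * (\<Sum>n\<in>?G. (norm (c n))\<^sup>2)"
      using card[of i] by (subst mult.commute) (intro mult_right_mono sum_nonneg, auto)
    finally show "(norm (v i))\<^sup>2 \<le> real M * (\<Sum>n\<in>?G. (norm (c n))\<^sup>2)" .
  qed
  also have "\<dots> = real M * (\<Sum>n\<in>F. (norm (c n))\<^sup>2)"
    unfolding sum_distrib_left[symmetric] sum.image_gen[OF \<open>finite F\<close>, of _ g, symmetric] ..
  finally show ?thesis .
qed

section \<open>Finite orthonormal sets and the size of a block\<close>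

definition orthonormal :: "'a set \<Rightarrow> bool" where
  "orthonormal E \<longleftrightarrow> (\<forall>e\<in>E. norm e = 1) \<and> (\<forall>e\<in>E. \<forall>f\<in>E. e \<noteq> f \<longrightarrow> ip e f = 0)"

lemma ip_sum_orthonormal:
  assumes "finite E" and "orthonormal E" and "e \<in> E"
  shows "ip (\<Sum>f\<in>E. smul (u f) f) e = u e"
proof -
  have "ip (\<Sum>f\<in>E. smul (u f) f) e = (\<Sum>f\<in>E. if f = e then u e else 0)"
    unfolding ip_sum_left ip_scale_left
    by (rule sum.cong) (use assms in \<open>auto simp: orthonormal_def ip_self\<close>)
  then show ?thesis
    using assms by simp
qed

lemma parseval:
  assumes "finite E" and "orthonormal E" and "v \<in> span E"
  shows "(norm v)\<^sup>2 = (\<Sum>e\<in>E. (norm (ip v e))\<^sup>2)"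
proof -
  obtain u where v: "v = (\<Sum>e\<in>E. smul (u e) e)"
    using assms by (auto simp: span_finite)
  have "(norm v)\<^sup>2 = (\<Sum>e\<in>E. (norm (smul (u e) e))\<^sup>2)"
    unfolding v
    by (rule pythagoras_sum)
      (use assms in \<open>auto simp: orthonormal_def ip_scale_left ip_scale_right\<close>)
  also have "\<dots> = (\<Sum>e\<in>E. (norm (ip v e))\<^sup>2)"
    using assms unfolding v
    by (intro sum.cong) (auto simp: norm_smul orthonormal_def ip_sum_orthonormal)
  finally show ?thesis .
qed

text \<open>By induction, the new vector \<open>a\<close> is split into its projection
  \<open>p\<close> onto the span of \<open>E\<close> and a remainder \<open>r\<close> orthogonal to
  \<open>E\<close>. If \<open>r\<close> vanishes, \<open>E\<close> still serves; otherwise the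
  normalized \<open>r\<close> joins it.\<close>

lemma gram_schmidt:
  assumes "finite A"
  shows "\<exists>E. finite E \<and> orthonormal E \<and> card E \<le> card A \<and> span A \<subseteq> span E"
  using assms
proof (induction A)
  case empty
  then show ?case
    by (intro exI[of _ "{}"]) (simp add: orthonormal_def)
next
  case (insert a A)
  then obtain E where E: "finite E" "orthonormal E" "card E \<le> card A" "span A \<subseteq> span E"
    by blast
  define p where "p = (\<Sum>e\<in>E. smul (ip a e) e)"
  define r where "r = a - p"
  have p: "p \<in> span E"
    unfolding p_def by (intro span_sum span_scale span_base)
  have r: "ip r e = 0" if "e \<in> E" for e
    using that E by (simp add: r_def p_def ip_diff_left ip_sum_orthonormal)
  show ?case
  proof (cases "r = 0")
    case True
    then have "a \<in> span E"
      using p by (simp add: r_def)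
    moreover have "A \<subseteq> span E"
      using E(4) span_superset by blast
    ultimately have "span (insert a A) \<subseteq> span E"
      by (intro span_minimal) auto
    then show ?thesis
      using E insert by (intro exI[of _ E]) auto
  next
    case False
    define q where "q = smul (of_real (1 / norm r)) r"
    have "norm q = 1"
      using False by (simp add: q_def norm_smul norm_divide)
    moreover have "ip q e = 0" if "e \<in> E" for e
      using r[OF that] by (simp add: q_def ip_scale_left)
    ultimately have "orthonormal (insert q E)"
      using E(2) ip_eq_zero_sym unfolding orthonormal_def by blast
    moreover have "a \<in> span (insert q E)"
    proof -
      have "r = smul (of_real (norm r)) q"
        using False unfolding q_def scale_of_real by simp
      then have "r \<in> span (insert q E)"
        by (metis insertI1 span_base span_scale)
      moreover have "p \<in> span (insert q E)"
        using p span_mono[of E "insert q E"] by blast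
      ultimately have "r + p \<in> span (insert q E)"
        by (rule span_add)
      then show ?thesis
        by (simp add: r_def)
    qed
    moreover have "A \<subseteq> span (insert q E)"
      using E(4) span_superset[of A] span_mono[of E "insert q E"] by blast
    ultimately show ?thesis
      using E insert
      by (intro exI[of _ "insert q E"] conjI span_minimal)
        (auto simp: card_insert_if)
  qed
qed

text \<open>Stated for a finite index set \<open>F\<close>, so that it applies to the finite subsets
  of a block before the block is known to be finite.\<close>

lemma card_le_bessel_bound:
  assumes "finite F" and "finite A"
    and unit: "\<And>n. n \<in> F \<Longrightarrow> norm (z n) = 1" and span: "\<And>n. n \<in> F \<Longrightarrow> z n \<in> span A"
    and bessel: "\<And>y. (\<Sum>n\<in>F. (norm (ip y (z n)))\<^sup>2) \<le> B * (norm y)\<^sup>2"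
    and "0 \<le> B"
  shows "real (card F) \<le> B * real (card A)"
proof -
  obtain E where E: "finite E" "orthonormal E" "card E \<le> card A" "span A \<subseteq> span E"
    using gram_schmidt[OF \<open>finite A\<close>] by blast
  have "real (card F) = (\<Sum>n\<in>F. (norm (z n))\<^sup>2)"
    using unit by simp
  also have "\<dots> = (\<Sum>n\<in>F. \<Sum>e\<in>E. (norm (ip (z n) e))\<^sup>2)"
    using E span by (intro sum.cong parseval) auto
  also have "\<dots> = (\<Sum>e\<in>E. \<Sum>n\<in>F. (norm (ip e (z n)))\<^sup>2)"
    unfolding norm_ip_commute[of "z _"] by (rule sum.swap)
  also have "\<dots> \<le> (\<Sum>e\<in>E. B)"
  proof (rule sum_mono)
    fix e assume "e \<in> E"
    then have "norm e = 1"
      using E(2) by (simp add: orthonormal_def)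
    then show "(\<Sum>n\<in>F. (norm (ip e (z n)))\<^sup>2) \<le> B"
      using bessel[of e] by simp
  qed
  also have "\<dots> \<le> B * real (card A)"
    using mult_left_mono[OF of_nat_mono[OF E(3)] \<open>0 \<le> B\<close>] by (simp add: mult.commute)
  finally show ?thesis .
qed

lemma edim_le_imp_span:
  assumes "edim smul V \<le> enat D"
  shows "\<exists>A. finite A \<and> card A \<le> D \<and> V \<subseteq> span A"
proof -
  obtain A0 where A0: "finite A0" "V \<subseteq> span A0" and D: "dim V \<le> D"
    using assms by (auto simp: edim_def split: if_splits)
  obtain A where A: "A \<subseteq> V" "independent A" "V \<subseteq> span A" "card A = dim V"
    using basis_exists by blast
  \<comment> \<open>An independent set inside the span of the finite set \<open>A0\<close> is
    finite.\<close>
  have "finite A"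
    using independent_span_bound[OF A0(1) A(2)] A(1) A0(2) by blast
  then show ?thesis
    using A D by auto
qed

end

section \<open>Finite suprema as uniform bounds, and the equivalence\<close>

lemma Sup_enat_less_top_iff: "(SUP i\<in>J. f i) < (\<infinity>::enat) \<longleftrightarrow> (\<exists>M. \<forall>i\<in>J. f i \<le> enat M)"
proof
  assume "(SUP i\<in>J. f i) < \<infinity>"
  then obtain M where "(SUP i\<in>J. f i) = enat M"
    by auto
  then show "\<exists>M. \<forall>i\<in>J. f i \<le> enat M"
    by (metis SUP_upper)
next
  assume "\<exists>M. \<forall>i\<in>J. f i \<le> enat M"
  then obtain M where "(SUP i\<in>J. f i) \<le> enat M"
    by (auto simp: SUP_le_iff)
  then show "(SUP i\<in>J. f i) < \<infinity>"
    using enat_ord_simps(4) le_less_trans by blast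
qed

lemma ecard_le_enat_iff: "ecard A \<le> enat M \<longleftrightarrow> finite A \<and> card A \<le> M"
  by (simp add: ecard_def)

theorem theorem3p4:
  fixes smul :: "'k::hilbert_scalar \<Rightarrow> 'a::{real_normed_vector, complete_space} \<Rightarrow> 'a"
    and ip :: "'a \<Rightarrow> 'a \<Rightarrow> 'k"
    and x :: "nat \<Rightarrow> 'a"
    and J :: "nat set"
    and N :: "nat \<Rightarrow> nat set"
  assumes "hilbert_space smul ip"
    and "separable_space (euclidean :: 'a topology)"
    and "\<And>n. x n \<noteq> 0"
    and "orthogonal_decomposition smul ip x J N"
    and "(SUP i\<in>J. edim smul (closed_span smul (x ` N i))) < \<infinity>"
  shows "bessel_normalizable ip x \<longleftrightarrow> (SUP i\<in>J. ecard (N i)) < \<infinity>"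
proof -
  interpret hilbert_space smul ip by fact
  define z where "z n = (1 / norm (x n)) *\<^sub>R x n" for n
  have unit: "norm (z n) = 1" for n
    using assms(3) by (simp add: z_def)
  \<comment> \<open>The real factor acts as a scalar of \<open>'k\<close> through
    \<open>scale_of_real\<close>.\<close>
  have z_span: "z n \<in> closed_span smul (x ` N i)" if "n \<in> N i" for n i
    unfolding z_def closed_span_def scale_of_real[symmetric]
    by (rule subsetD[OF closure_subset], intro span_scale span_base) (use that in simp)
  have cover: "\<exists>i\<in>J. n \<in> N i" for n
    using assms(4) unfolding orthogonal_decomposition_def by blast
  have normalizable: "bessel_normalizable ip x \<longleftrightarrow> bessel_sequence ip z"
    using assms(3) unfolding bessel_normalizable_def z_def by simp
  show ?thesis
    unfolding normalizable Sup_enat_less_top_iff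
  proof
    assume "bessel_sequence ip z"
    then obtain B where
      summ: "\<And>y. summable (\<lambda>n. (norm (ip y (z n)))\<^sup>2)" and
      B: "\<And>y. (\<Sum>n. (norm (ip y (z n)))\<^sup>2) \<le> B * (norm y)\<^sup>2"
      unfolding bessel_sequence_def by blast
    \<comment> \<open>A Bessel constant may be any real by definition; testing it on the unit vector
      \<open>z 0\<close> shows that it is nonnegative.\<close>
    have "0 \<le> (\<Sum>n. (norm (ip (z 0) (z n)))\<^sup>2)"
      by (intro suminf_nonneg summ) simp
    with B[of "z 0"] have B0: "0 \<le> B"
      by (simp add: unit)
    have fin: "(\<Sum>n\<in>F. (norm (ip y (z n)))\<^sup>2) \<le> B * (norm y)\<^sup>2" if "finite F" for F y
      using sum_le_suminf[OF summ that, of y] B[of y] by simp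
    obtain D where D: "\<And>i. i \<in> J \<Longrightarrow> edim smul (closed_span smul (x ` N i)) \<le> enat D"
      using assms(5) unfolding Sup_enat_less_top_iff by blast
    define M where "M = nat \<lfloor>B * real D\<rfloor>"
    have "ecard (N i) \<le> enat M" if i: "i \<in> J" for i
    proof -
      obtain A where A: "finite A" "card A \<le> D" "closed_span smul (x ` N i) \<subseteq> span A"
        using edim_le_imp_span[OF D[OF i]] by blast
      have card_F: "card F \<le> M" if "finite F" "F \<subseteq> N i" for F
      proof -
        have "real (card F) \<le> B * real (card A)"
        proof (rule card_le_bessel_bound[OF that(1) A(1) unit _ fin[OF that(1)] B0])
          show "z n \<in> span A" if "n \<in> F" for n
            using z_span[of n i] A(3) \<open>F \<subseteq> N i\<close> that by (meson subsetD)
        qed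
        also have "\<dots> \<le> B * real D"
          using A(2) B0 by (simp add: mult_left_mono)
        finally show ?thesis
          unfolding M_def by (simp add: le_nat_floor)
      qed
      \<comment> \<open>The bound \<open>card_F\<close> excludes a subset with \<open>M + 1\<close>
        elements, which an infinite block would have.\<close>
      have "finite (N i)"
      proof (rule ccontr)
        assume "infinite (N i)"
        then obtain F where "finite F" "card F = Suc M" "F \<subseteq> N i"
          using infinite_arbitrarily_large by metis
        with card_F[of F] show False
          by simp
      qed
      then show ?thesis
        using card_F by (simp add: ecard_le_enat_iff)
    qed
    then show "\<exists>M. \<forall>i\<in>J. ecard (N i) \<le> enat M"
      by blast
  next
    assume "\<exists>M. \<forall>i\<in>J. ecard (N i) \<le> enat M"
    then obtain M where M: "\<And>i. i \<in> J \<Longrightarrow> finite (N i) \<and> card (N i) \<le> M"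
      unfolding ecard_le_enat_iff by blast
    obtain g where g: "\<And>n. g n \<in> J" "\<And>n. n \<in> N (g n)"
      using cover by metis
    have orth: "ip (z m) (z n) = 0" if "g m \<noteq> g n" for m n
    proof -
      have "\<forall>u\<in>closed_span smul (x ` N (g m)). \<forall>v\<in>closed_span smul (x ` N (g n)). ip u v = 0"
        using assms(4) that g(1) unfolding orthogonal_decomposition_def by blast
      then show ?thesis
        using z_span[OF g(2)] by simp
    qed
    \<comment> \<open>For \<open>i\<close> in \<open>J\<close> the indices labelled \<open>i\<close>
      lie in \<open>N i\<close>; any other \<open>i\<close> labels none.\<close>
    have card_g: "card {n \<in> F. g n = i} \<le> M" for F i
    proof (cases "i \<in> J")
      case True
      then have "card {n \<in> F. g n = i} \<le> card (N i)"
        using M g by (intro card_mono) auto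
      with True M show ?thesis
        using le_trans by blast
    next
      case False
      then have "{n \<in> F. g n = i} = {}"
        using g by blast
      then show ?thesis by (simp only: card.empty)
    qed
    have bound: "(\<Sum>n<k. (norm (ip y (z n)))\<^sup>2) \<le> real M * (norm y)\<^sup>2" for k y
    proof (rule analysis_bound)
      show "(norm (\<Sum>n<k. smul (c n) (z n)))\<^sup>2 \<le> real M * (\<Sum>n<k. (norm (c n))\<^sup>2)" for c
        by (rule synthesis_bound[where g = g]) (simp, rule unit, erule orth, rule card_g)
    qed simp_all
    \<comment> \<open>The bound on initial segments does not depend on \<open>k\<close>, so the
      nonnegative series converges and its sum obeys the same bound.\<close>
    have "summable (\<lambda>n. (norm (ip y (z n)))\<^sup>2)" for y
      by (rule summableI_nonneg_bounded[OF _ bound]) simp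
    moreover from this have "(\<Sum>n. (norm (ip y (z n)))\<^sup>2) \<le> real M * (norm y)\<^sup>2" for y
      by (rule suminf_le_const) (rule bound)
    ultimately show "bessel_sequence ip z"
      unfolding bessel_sequence_def by blast
  qed
qed

end
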